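(* There is a functor $\mathsf{PD}: \mathsf{CPMod} \to \mathsf{Dgm}$, from the category of constructible persistence modules to the category of persistence diagrams, assigning to each constructible persistence module $M$ the persistence diagram $\partial\,\mathsf{null}_M$.
   Context: Fix a field $\mathbb{K}$; $\mathsf{Vec}$ is the category of finite-dimensional $\mathbb{K}$-vector spaces. Posets are regarded as categories. A Galois connection $f:P\leftrightarrows Q:g$ between posets consists of order-preserving maps $f:P\to Q$, $g:Q\to P$ with $f(p)\le q\iff p\le g(q)$; it is a Galois insertion if moreover $f\circ g=\mathrm{id}_Q$. The category $\mathsf{PMod}$ of persistence modules has as objects functors $M:P\to\mathsf{Vec}$, for any poset $P$; a morphism from $M:P\to\mathsf{Vec}$ to $N:Q\to\mathsf{Vec}$ is a Galois insertion $f:P\leftrightarrows Q:g$ such that $M\circ g\cong N$ (natural isomorphism). Morphisms compose by composing Galois insertions. A co-closure operator on $P$ is an order-preserving map $c:P\to P$ with $c(p)\le p$ for all $p$ and $c\circ c=c$. For a finite subposet $S\subseteq P$, $M:P\to\mathsf{Vec}$ is $S$-constructible if there is a co-closure operator $c$ on $P$ with image $S$ and $M\circ c\cong M$; $M$ is constructible if it is $S$-constructible for some finite $S$. $\mathsf{CPMod}$ is the full subcategory of $\mathsf{PMod}$ on the constructible persistence modules. For a poset $P$, $\bar P=\{(a,b)\in P\times P: a\le b\}$ with the product order $(a,b)\le(c,d)$ iff $a\le c$ and $b\le d$. Its diagonal is $\Delta_P=\{(a,a)\}$ and $\bar P^\circ=\bar P\setminus\Delta_P$. An order-preserving $f:P\to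 Q$ induces $\bar f:\bar P\to\bar Q$, $\bar f(a,b)=(f(a),f(b))$. For a function $h:A\to B$ and $m:A\to\mathbb{Z}$ the pushforward is $(h_\sharp m)(b)=\sum_{a\in h^{-1}(b)}m(a)$. A persistence diagram is a finitely supported function $w:\bar P\to\mathbb{Z}$ for some poset $P$. The category $\mathsf{Dgm}$ has persistence diagrams as objects; a morphism from $w_0:\bar P\to\mathbb{Z}$ to $w_1:\bar Q\to\mathbb{Z}$ is an order-preserving map $f:P\to Q$ such that $(\bar f_\sharp w_0)|_{\bar Q^\circ}=w_1|_{\bar Q^\circ}$. The nullity function of $M:P\to\mathsf{Vec}$ is $\mathsf{null}_M:\bar P\to\mathbb{Z}$, $\mathsf{null}_M(a,b)=\dim\ker M(a\le b)$. The Möbius inversion of a function $m:X\to\mathbb{Z}$ on a poset $X$ is the (unique, if it exists) function $\partial m:X\to\mathbb{Z}$ with $m(y)=\sum_{x\le y}\partial m(x)$ for all $y$, each sum having only finitely many nonzero terms. If $M$ is constructible then $\mathsf{null}_M$ has a Möbius inversion $\partial\,\mathsf{null}_M$ (on $\bar P$) and it is finitely supported. *)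

theory Defs
  imports
    "HOL-Library.FuncSet"
    "Jordan_Normal_Form.Missing_VectorSpace"
begin

section \<open>Categories and functors\<close>

text \<open>
  Hom-sets are indexed by their source and target and need not be disjoint, so identities and
  composition take the objects as arguments: \<open>Cmp C a b c g f\<close> is
  \<open>g \<circ> f\<close> for \<open>f : a \<rightarrow> b\<close> and
  \<open>g : b \<rightarrow> c\<close>.
\<close>

record ('o, 'm) cat =
  Ob  :: "'o set"
  Hom :: "'o \<Rightarrow> 'o \<Rightarrow> 'm set"
  Idn :: "'o \<Rightarrow> 'm"
  Cmp :: "'o \<Rightarrow> 'o \<Rightarrow> 'o \<Rightarrow> 'm \<Rightarrow> 'm \<Rightarrow> 'm"

locale category =
  fixes C :: "('o, 'm) cat"
  assumes Idn_in_Hom: "a \<in> Ob C \<Longrightarrow> Idn C a \<in> Hom C a a"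
    and Cmp_in_Hom: "\<lbrakk>a \<in> Ob C; b \<in> Ob C; c \<in> Ob C; f \<in> Hom C a b; g \<in> Hom C b c\<rbrakk>
      \<Longrightarrow> Cmp C a b c g f \<in> Hom C a c"
    and Cmp_Idn_left: "\<lbrakk>a \<in> Ob C; b \<in> Ob C; f \<in> Hom C a b\<rbrakk>
      \<Longrightarrow> Cmp C a b b (Idn C b) f = f"
    and Cmp_Idn_right: "\<lbrakk>a \<in> Ob C; b \<in> Ob C; f \<in> Hom C a b\<rbrakk>
      \<Longrightarrow> Cmp C a a b f (Idn C a) = f"
    and Cmp_assoc: "\<lbrakk>a \<in> Ob C; b \<in> Ob C; c \<in> Ob C; d \<in> Ob C;
        f \<in> Hom C a b; g \<in> Hom C b c; h \<in> Hom C c d\<rbrakk>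
      \<Longrightarrow> Cmp C a c d h (Cmp C a b c g f) = Cmp C a b d (Cmp C b c d h g) f"

record ('o, 'm, 'p, 'n) fctr =
  FOb :: "'o \<Rightarrow> 'p"
  FAr :: "'o \<Rightarrow> 'o \<Rightarrow> 'm \<Rightarrow> 'n"

text \<open>
  The two extensionality conditions make equality of functors in HOL coincide with the equality
  of their actions on the objects and arrows of the source category.
\<close>

locale cat_functor = src: category C + tgt: category D
  for C :: "('o, 'm) cat" and D :: "('p, 'n) cat" +
  fixes F :: "('o, 'm, 'p, 'n) fctr"
  assumes FOb_in_Ob: "a \<in> Ob C \<Longrightarrow> FOb F a \<in> Ob D"
    and FAr_in_Hom: "\<lbrakk>a \<in> Ob C; b \<in> Ob C; f \<in> Hom C a b\<rbrakk>
      \<Longrightarrow> FAr F a b f \<in> Hom D (FOb F a) (FOb F b)"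
    and FAr_Idn: "a \<in> Ob C \<Longrightarrow> FAr F a a (Idn C a) = Idn D (FOb F a)"
    and FAr_Cmp: "\<lbrakk>a \<in> Ob C; b \<in> Ob C; c \<in> Ob C; f \<in> Hom C a b; g \<in> Hom C b c\<rbrakk>
      \<Longrightarrow> FAr F a c (Cmp C a b c g f)
          = Cmp D (FOb F a) (FOb F b) (FOb F c) (FAr F b c g) (FAr F a b f)"
    and FOb_ext: "a \<notin> Ob C \<Longrightarrow> FOb F a = undefined"
    and FAr_ext: "\<not> (a \<in> Ob C \<and> b \<in> Ob C \<and> f \<in> Hom C a b) \<Longrightarrow> FAr F a b f = undefined"

definition fctr_comp ::
  "('o, 'm) cat \<Rightarrow> ('p, 'n, 'q, 'l) fctr \<Rightarrow> ('o, 'm, 'p, 'n) fctr \<Rightarrow> ('o, 'm, 'q, 'l) fctr"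
  where "fctr_comp C G F =
    \<lparr>FOb = (\<lambda>a. if a \<in> Ob C then FOb G (FOb F a) else undefined),
     FAr = (\<lambda>a b f. if a \<in> Ob C \<and> b \<in> Ob C \<and> f \<in> Hom C a b
                    then FAr G (FOb F a) (FOb F b) (FAr F a b f) else undefined)\<rparr>"

definition is_iso :: "('o, 'm) cat \<Rightarrow> 'o \<Rightarrow> 'o \<Rightarrow> 'm \<Rightarrow> bool"
  where "is_iso C a b f \<longleftrightarrow> f \<in> Hom C a b \<and>
    (\<exists>g \<in> Hom C b a. Cmp C a b a g f = Idn C a \<and> Cmp C b a b f g = Idn C b)"

definition naturally_isomorphic ::
  "('o, 'm) cat \<Rightarrow> ('p, 'n) cat \<Rightarrow> ('o, 'm, 'p, 'n) fctr \<Rightarrow> ('o, 'm, 'p, 'n) fctr \<Rightarrow> bool"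
  where "naturally_isomorphic C D F G \<longleftrightarrow>
    (\<exists>\<eta>. (\<forall>a \<in> Ob C. is_iso D (FOb F a) (FOb G a) (\<eta> a)) \<and>
         (\<forall>a \<in> Ob C. \<forall>b \<in> Ob C. \<forall>f \<in> Hom C a b.
            Cmp D (FOb F a) (FOb F b) (FOb G b) (\<eta> b) (FAr F a b f)
              = Cmp D (FOb F a) (FOb G a) (FOb G b) (FAr G a b f) (\<eta> a)))"

definition full_subcategory :: "('o, 'm) cat \<Rightarrow> ('o \<Rightarrow> bool) \<Rightarrow> ('o, 'm) cat"
  where "full_subcategory C p = C\<lparr>Ob := {a \<in> Ob C. p a}\<rparr>"


section \<open>Posets\<close>

text \<open>
  A poset is a relation \<open>P\<close> with \<^prop>\<open>Partial_order P\<close>; its carrier is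
  \<^term>\<open>Field P\<close>, and \<open>a \<le> b\<close> is
  \<^prop>\<open>(a, b) \<in> P\<close>. Maps between posets are extensional, i.e. equal to
  \<^const>\<open>undefined\<close> off the carrier of the source.
\<close>

definition poset_cat :: "'a rel \<Rightarrow> ('a, unit) cat"
  where "poset_cat P =
    \<lparr>Ob = Field P, Hom = (\<lambda>a b. if (a, b) \<in> P then {()} else {}),
     Idn = (\<lambda>_. ()), Cmp = (\<lambda>_ _ _ _ _. ())\<rparr>"

definition order_preserving :: "'a rel \<Rightarrow> 'b rel \<Rightarrow> ('a \<Rightarrow> 'b) set"
  where "order_preserving P Q = {f \<in> Field P \<rightarrow>\<^sub>E Field Q.
    monotone_on (Field P) (\<lambda>x y. (x, y) \<in> P) (\<lambda>x y. (x, y) \<in> Q) f}"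

definition map_fctr :: "'a rel \<Rightarrow> ('a \<Rightarrow> 'b) \<Rightarrow> ('a, unit, 'b, unit) fctr"
  where "map_fctr P f = \<lparr>FOb = restrict f (Field P), FAr = (\<lambda>_ _ _. ())\<rparr>"

definition galois_insertion :: "'a rel \<Rightarrow> 'b rel \<Rightarrow> ('a \<Rightarrow> 'b) \<Rightarrow> ('b \<Rightarrow> 'a) \<Rightarrow> bool"
  where "galois_insertion P Q f g \<longleftrightarrow>
    f \<in> order_preserving P Q \<and> g \<in> order_preserving Q P \<and>
    (\<forall>p \<in> Field P. \<forall>q \<in> Field Q. (f p, q) \<in> Q \<longleftrightarrow> (p, g q) \<in> P) \<and>
    (\<forall>q \<in> Field Q. f (g q) = q)"

definition coclosure_operator :: "'a rel \<Rightarrow> ('a \<Rightarrow> 'a) \<Rightarrow> bool"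
  where "coclosure_operator P c \<longleftrightarrow>
    c \<in> order_preserving P P \<and> (\<forall>p \<in> Field P. (c p, p) \<in> P \<and> c (c p) = c p)"

text \<open>
  The carrier of \<open>bar_poset P\<close> is the set of pairs \<open>(a, b)\<close> with
  \<open>a \<le> b\<close>, that is, the set \<open>P\<close> itself.
\<close>

definition bar_poset :: "'a rel \<Rightarrow> ('a \<times> 'a) rel"
  where "bar_poset P = {((a, b), (c, d)) | a b c d.
    (a, b) \<in> P \<and> (c, d) \<in> P \<and> (a, c) \<in> P \<and> (b, d) \<in> P}"

lemma Field_bar_poset:
  assumes "Partial_order P"
  shows "Field (bar_poset P) = P"
proof -
  have r: "(x, x) \<in> P" if "x \<in> Field P" for x
    using assms that by (auto simp: order_on_defs refl_on_def)
  have "(a, b) \<in> Field (bar_poset P)" if "(a, b) \<in> P" for a b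
    using that r[OF FieldI1[OF that]] r[OF FieldI2[OF that]]
    by (intro FieldI1[of _ "(a, b)"]) (auto simp: bar_poset_def)
  moreover have "Field (bar_poset P) \<subseteq> P"
    by (auto simp: Field_def bar_poset_def)
  ultimately show ?thesis
    by auto
qed

definition off_diagonal :: "'a rel \<Rightarrow> ('a \<times> 'a) set"
  where "off_diagonal P = Field (bar_poset P) - Id_on (Field P)"


section \<open>Persistence modules\<close>

text \<open>
  The objects of \<open>vec_cat K\<close> are the finite-dimensional \<open>K\<close>-vector spaces
  whose vectors are drawn from the type \<^typ>\<open>'v\<close>; the arrows are extensional linear
  maps.
\<close>

definition vec_cat :: "('k, 'r) ring_scheme \<Rightarrow> (('k, 'v) module, 'v \<Rightarrow> 'v) cat"
  where "vec_cat K =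
    \<lparr>Ob = {V. vectorspace K V \<and> vectorspace.fin_dim K V},
     Hom = (\<lambda>V W. {T \<in> extensional (carrier V). linear_map K V W T}),
     Idn = (\<lambda>V. \<lambda>v \<in> carrier V. v),
     Cmp = (\<lambda>U V W S T. compose (carrier U) S T)\<rparr>"

type_synonym ('a, 'k, 'v) pmodule = "'a rel \<times> ('a, unit, ('k, 'v) module, 'v \<Rightarrow> 'v) fctr"

definition PMod :: "('k, 'r) ring_scheme \<Rightarrow> (('a, 'k, 'v) pmodule, ('a \<Rightarrow> 'a) \<times> ('a \<Rightarrow> 'a)) cat"
  where "PMod K =
    \<lparr>Ob = {(P, M). Partial_order P \<and> cat_functor (poset_cat P) (vec_cat K) M},
     Hom = (\<lambda>(P, M) (Q, N). {(f, g). galois_insertion P Q f g \<and>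
       naturally_isomorphic (poset_cat Q) (vec_cat K)
         (fctr_comp (poset_cat Q) M (map_fctr Q g)) N}),
     Idn = (\<lambda>(P, M). (\<lambda>x \<in> Field P. x, \<lambda>x \<in> Field P. x)),
     Cmp = (\<lambda>(P, L) (Q, M) (R, N) (f', g') (f, g).
       (compose (Field P) f' f, compose (Field R) g g'))\<rparr>"

definition constructible_on ::
  "('k, 'r) ring_scheme \<Rightarrow> 'a set \<Rightarrow> ('a, 'k, 'v) pmodule \<Rightarrow> bool"
  where "constructible_on K S = (\<lambda>(P, M).
    \<exists>c. coclosure_operator P c \<and> c ` Field P = S \<and>
      naturally_isomorphic (poset_cat P) (vec_cat K)
        (fctr_comp (poset_cat P) M (map_fctr P c)) M)"

definition constructible :: "('k, 'r) ring_scheme \<Rightarrow> ('a, 'k, 'v) pmodule \<Rightarrow> bool"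
  where "constructible K X \<longleftrightarrow> (\<exists>S \<subseteq> Field (fst X). finite S \<and> constructible_on K S X)"

definition CPMod :: "('k, 'r) ring_scheme \<Rightarrow> (('a, 'k, 'v) pmodule, ('a \<Rightarrow> 'a) \<times> ('a \<Rightarrow> 'a)) cat"
  where "CPMod K = full_subcategory (PMod K) (constructible K)"

definition nullity :: "('k, 'r) ring_scheme \<Rightarrow> ('a, 'k, 'v) pmodule \<Rightarrow> 'a \<times> 'a \<Rightarrow> int"
  where "nullity K = (\<lambda>(P, M). \<lambda>(a, b) \<in> Field (bar_poset P).
    int (vectorspace.dim K
      ((FOb M a)\<lparr>carrier := mod_hom.ker (FOb M a) (FOb M b) (FAr M a b ())\<rparr>)))"


section \<open>Persistence diagrams\<close>

text \<open>
  The sum ranges over the support of \<open>m\<close> in the fibre, because \<^const>\<open>sum\<close>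
  over an infinite fibre would be \<open>0\<close> even if \<open>m\<close> has finite support.
\<close>

definition pushforward :: "'a set \<Rightarrow> ('a \<Rightarrow> 'b) \<Rightarrow> ('a \<Rightarrow> int) \<Rightarrow> 'b \<Rightarrow> int"
  where "pushforward A h m b = (\<Sum>a \<in> {a \<in> A. h a = b \<and> m a \<noteq> 0}. m a)"

type_synonym 'a diagram = "'a rel \<times> ('a \<times> 'a \<Rightarrow> int)"

definition Dgm :: "('a diagram, 'a \<Rightarrow> 'a) cat"
  where "Dgm =
    \<lparr>Ob = {(P, w). Partial_order P \<and> w \<in> extensional (Field (bar_poset P)) \<and>
       finite {x \<in> Field (bar_poset P). w x \<noteq> 0}},
     Hom = (\<lambda>(P, w) (Q, w'). {f \<in> order_preserving P Q.
       \<forall>y \<in> off_diagonal Q. pushforward (Field (bar_poset P)) (map_prod f f) w y = w' y}),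
     Idn = (\<lambda>(P, w). \<lambda>x \<in> Field P. x),
     Cmp = (\<lambda>(P, _) _ _ g f. compose (Field P) g f)\<rparr>"

definition moebius_inversion :: "'a rel \<Rightarrow> ('a \<Rightarrow> int) \<Rightarrow> ('a \<Rightarrow> int) \<Rightarrow> bool"
  where "moebius_inversion X m d \<longleftrightarrow> d \<in> extensional (Field X) \<and>
    (\<forall>y \<in> Field X. finite {x. (x, y) \<in> X \<and> d x \<noteq> 0} \<and>
      m y = (\<Sum>x \<in> {x. (x, y) \<in> X \<and> d x \<noteq> 0}. d x))"

lemma moebius_inversion_unique:
  assumes X: "Partial_order X" and d: "moebius_inversion X m d" and e: "moebius_inversion X m e"
  shows "d = e"
proof (rule ccontr)
  assume "d \<noteq> e"
  have refl: "\<And>x. x \<in> Field X \<Longrightarrow> (x, x) \<in> X" and trans: "trans X" and anti: "antisym X"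
    using X by (auto simp: order_on_defs refl_on_def)
  obtain z where z: "d z \<noteq> e z"
    using \<open>d \<noteq> e\<close> by blast
  have zX: "z \<in> Field X"
    using d e z unfolding moebius_inversion_def extensional_def by (metis (mono_tags, lifting) mem_Collect_eq)
  let ?D = "\<lambda>y. {x. (x, y) \<in> X \<and> d x \<noteq> 0} \<union> {x. (x, y) \<in> X \<and> e x \<noteq> 0}"
  let ?B = "{x. (x, z) \<in> X \<and> d x \<noteq> e x}"
  have "finite (?D z)"
    using d e zX unfolding moebius_inversion_def by auto
  then have "finite ?B"
    by (rule rev_finite_subset) auto
  moreover have "wf ((X - Id) \<inter> ?B \<times> ?B)"
  proof (rule finite_acyclic_wf)
    show "finite ((X - Id) \<inter> ?B \<times> ?B)"
      using \<open>finite ?B\<close> by blast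
    have "acyclic (X - Id)"
      by (rule acyclicI) (simp add: trancl_id trans anti trans_diff_Id)
    then show "acyclic ((X - Id) \<inter> ?B \<times> ?B)"
      by (rule acyclic_subset) auto
  qed
  moreover have "z \<in> ?B"
    using z refl[OF zX] by simp
  ultimately obtain y where y: "y \<in> ?B"
    and min: "\<And>x. (x, y) \<in> (X - Id) \<inter> ?B \<times> ?B \<Longrightarrow> x \<notin> ?B"
    by (metis (no_types, lifting) wfE_min)
  have yX: "y \<in> Field X"
    using y by (auto intro: FieldI1)
  have below: "d x = e x" if "(x, y) \<in> X" "x \<noteq> y" for x
    using min[of x] that y transD[OF trans that(1)] by auto
  have finD: "finite (?D y)"
    using d e yX unfolding moebius_inversion_def by auto
  have "m y = sum d (?D y)"
  proof -
    have "m y = (\<Sum>x \<in> {x. (x, y) \<in> X \<and> d x \<noteq> 0}. d x)"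
      using d yX unfolding moebius_inversion_def by auto
    also have "\<dots> = sum d (?D y)"
      using finD by (intro sum.mono_neutral_left) auto
    finally show ?thesis .
  qed
  moreover have "m y = sum e (?D y)"
  proof -
    have "m y = (\<Sum>x \<in> {x. (x, y) \<in> X \<and> e x \<noteq> 0}. e x)"
      using e yX unfolding moebius_inversion_def by auto
    also have "\<dots> = sum e (?D y)"
      using finD by (intro sum.mono_neutral_left) auto
    finally show ?thesis .
  qed
  moreover have "y \<in> ?D y"
    using y refl[OF yX] by auto
  moreover have "sum d (?D y - {y}) = sum e (?D y - {y})"
    by (rule sum.cong) (use below in auto)
  ultimately have "d y = e y"
    using finD sum.remove[of "?D y" y d] sum.remove[of "?D y" y e] by linarith
  then show False
    using y by simp
qed

end

theory Submission
  imports Defs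
begin

text \<open>
  Everything rests on one fact about a Galois connection with left adjoint \<open>f\<close> and right
  adjoint \<open>g\<close>: if \<open>d\<close> is a finitely supported Moebius inversion of
  \<open>m\<close>, then its pushforward along \<open>f\<close> is the Moebius inversion of
  \<open>m \<circ> g\<close>, since \<open>f x \<le> y\<close> and \<open>x \<le> g y\<close> are the
  same condition on \<open>x\<close> (\<open>moebius_inversion_pushforward\<close>). It is used twice.

  For existence, let \<open>c\<close> be a co-closure operator with finite image and
  \<open>M \<circ> c \<cong> M\<close>. On the poset of pairs \<open>c\<close> acts as a co-closure operator with
  finite image that leaves the nullity of \<open>M\<close> unchanged. It is right adjoint to the
  inclusion of its image; over that finite image an inversion exists because the defining equations
  are triangular, and its pushforward along the inclusion is a finitely supported
  inversion of the nullity (\<open>nullity_moebius_inversion\<close>).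

  For functoriality, let the Galois insertion \<open>(f, g)\<close> be a morphism from \<open>M\<close> to
  \<open>N\<close>, so that \<open>M \<circ> g \<cong> N\<close>. Then the nullity of \<open>N\<close> is that
  of \<open>M\<close> composed with \<open>g\<close>, and uniqueness of inversions identifies the pushforward
  of the diagram of \<open>M\<close> with the diagram of \<open>N\<close>
  (\<open>nullity_diagram_morphism\<close>). Sending \<open>(f, g)\<close> to \<open>f\<close> is
  compatible with identities and composition by construction.

  The only fact from linear algebra with content is the invariance of the nullity under natural isomorphism
  (\<open>dim_ker_iso_invariant\<close>). The rest checks that modules and diagrams do form categories;
  the points that need an argument are that natural isomorphisms can be whiskered and composed, and
  that pushforwards compose off the diagonal (\<open>pushforward_comp\<close>).
\<close>

section \<open>Functors, natural isomorphisms and posets\<close>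

lemma category_full_subcategory:
  assumes "category C"
  shows "category (full_subcategory C p)"
proof -
  interpret category C by fact
  show ?thesis
    by unfold_locales
      (auto simp: full_subcategory_def intro: Idn_in_Hom Cmp_in_Hom Cmp_Idn_left Cmp_Idn_right Cmp_assoc)
qed

lemma cat_functor_fctr_comp:
  assumes "cat_functor C D F" "cat_functor D E G"
  shows "cat_functor C E (fctr_comp C G F)"
proof -
  interpret F: cat_functor C D F by fact
  interpret G: cat_functor D E G by fact
  show ?thesis
    by unfold_locales
      (auto simp: fctr_comp_def F.FOb_in_Ob F.FAr_in_Hom F.FAr_Idn F.FAr_Cmp F.src.Idn_in_Hom
        F.src.Cmp_in_Hom G.FOb_in_Ob G.FAr_in_Hom G.FAr_Idn G.FAr_Cmp)
qed

lemma fctr_comp_assoc: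
  assumes "cat_functor C D F"
  shows "fctr_comp C (fctr_comp D H G) F = fctr_comp C H (fctr_comp C G F)"
proof -
  interpret F: cat_functor C D F by fact
  show ?thesis
    by (auto simp: fctr_comp_def F.FOb_in_Ob F.FAr_in_Hom fun_eq_iff)
qed

lemma naturally_isomorphic_refl:
  assumes "cat_functor C D F"
  shows "naturally_isomorphic C D F F"
proof -
  interpret F: cat_functor C D F by fact
  show ?thesis
    unfolding naturally_isomorphic_def is_iso_def
    by (rule exI[of _ "\<lambda>a. Idn D (FOb F a)"])
      (use F.FOb_in_Ob F.tgt.Idn_in_Hom F.tgt.Cmp_Idn_left F.tgt.Cmp_Idn_right F.FAr_in_Hom in
        \<open>auto intro!: bexI\<close>)
qed

lemma is_iso_Cmp:
  assumes "category D" and ob: "a \<in> Ob D" "b \<in> Ob D" "c \<in> Ob D"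
    and s: "is_iso D a b s" and t: "is_iso D b c t"
  shows "is_iso D a c (Cmp D a b c t s)"
proof -
  interpret category D by fact
  obtain s' where s': "s' \<in> Hom D b a" "Cmp D a b a s' s = Idn D a" "Cmp D b a b s s' = Idn D b"
    and sh: "s \<in> Hom D a b"
    using s unfolding is_iso_def by blast
  obtain t' where t': "t' \<in> Hom D c b" "Cmp D b c b t' t = Idn D b" "Cmp D c b c t t' = Idn D c"
    and th: "t \<in> Hom D b c"
    using t unfolding is_iso_def by blast
  let ?ts = "Cmp D a b c t s" and ?st = "Cmp D c b a s' t'"
  have h: "?ts \<in> Hom D a c" "?st \<in> Hom D c a"
    using ob sh th s'(1) t'(1) by (auto intro: Cmp_in_Hom)
  have "Cmp D a c a ?st ?ts = Cmp D a b a s' (Cmp D a c b t' ?ts)"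
    using Cmp_assoc[OF ob(1,3,2,1) h(1) t'(1) s'(1)] by simp
  also have "Cmp D a c b t' ?ts = Cmp D a b b (Cmp D b c b t' t) s"
    using Cmp_assoc[OF ob(1,2,3,2) sh th t'(1)] .
  finally have 1: "Cmp D a c a ?st ?ts = Idn D a"
    using ob sh s' t' by (simp add: Cmp_Idn_left)
  have "Cmp D c a c ?ts ?st = Cmp D c b c t (Cmp D c a b s ?st)"
    using Cmp_assoc[OF ob(3,1,2,3) h(2) sh th] by simp
  also have "Cmp D c a b s ?st = Cmp D c b b (Cmp D b a b s s') t'"
    using Cmp_assoc[OF ob(3,2,1,2) t'(1) s'(1) sh] .
  finally have "Cmp D c a c ?ts ?st = Idn D c"
    using ob th s' t' by (simp add: Cmp_Idn_left)
  with 1 h show ?thesis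
    unfolding is_iso_def by blast
qed

lemma naturally_isomorphic_trans:
  assumes "cat_functor C D F" "cat_functor C D G" "cat_functor C D H"
    and FG: "naturally_isomorphic C D F G" and GH: "naturally_isomorphic C D G H"
  shows "naturally_isomorphic C D F H"
proof -
  interpret F: cat_functor C D F by fact
  interpret G: cat_functor C D G by fact
  interpret H: cat_functor C D H by fact
  obtain s where s: "\<And>a. a \<in> Ob C \<Longrightarrow> is_iso D (FOb F a) (FOb G a) (s a)"
    and sn: "\<And>a b f. \<lbrakk>a \<in> Ob C; b \<in> Ob C; f \<in> Hom C a b\<rbrakk> \<Longrightarrow>
      Cmp D (FOb F a) (FOb F b) (FOb G b) (s b) (FAr F a b f)
        = Cmp D (FOb F a) (FOb G a) (FOb G b) (FAr G a b f) (s a)"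
    using FG unfolding naturally_isomorphic_def by blast
  obtain t where t: "\<And>a. a \<in> Ob C \<Longrightarrow> is_iso D (FOb G a) (FOb H a) (t a)"
    and tn: "\<And>a b f. \<lbrakk>a \<in> Ob C; b \<in> Ob C; f \<in> Hom C a b\<rbrakk> \<Longrightarrow>
      Cmp D (FOb G a) (FOb G b) (FOb H b) (t b) (FAr G a b f)
        = Cmp D (FOb G a) (FOb H a) (FOb H b) (FAr H a b f) (t a)"
    using GH unfolding naturally_isomorphic_def by blast
  have sh: "s a \<in> Hom D (FOb F a) (FOb G a)" and th: "t a \<in> Hom D (FOb G a) (FOb H a)"
    if "a \<in> Ob C" for a
    using s[OF that] t[OF that] by (auto simp: is_iso_def)
  note ob = F.FOb_in_Ob G.FOb_in_Ob H.FOb_in_Ob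
  let ?r = "\<lambda>a. Cmp D (FOb F a) (FOb G a) (FOb H a) (t a) (s a)"
  show ?thesis
    unfolding naturally_isomorphic_def
  proof (intro exI[of _ ?r] conjI ballI)
    fix a assume "a \<in> Ob C"
    then show "is_iso D (FOb F a) (FOb H a) (?r a)"
      by (intro is_iso_Cmp F.tgt.category_axioms ob s t)
  next
    fix a b f assume a: "a \<in> Ob C" and b: "b \<in> Ob C" and f: "f \<in> Hom C a b"
    note ar = F.FAr_in_Hom[OF a b f] G.FAr_in_Hom[OF a b f] H.FAr_in_Hom[OF a b f]
    have "Cmp D (FOb F a) (FOb F b) (FOb H b) (?r b) (FAr F a b f)
      = Cmp D (FOb F a) (FOb G b) (FOb H b) (t b)
          (Cmp D (FOb F a) (FOb F b) (FOb G b) (s b) (FAr F a b f))"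
      using F.tgt.Cmp_assoc[OF _ _ _ _ ar(1) sh[OF b] th[OF b]] ob a b by simp
    also have "\<dots> = Cmp D (FOb F a) (FOb G a) (FOb H b)
        (Cmp D (FOb G a) (FOb G b) (FOb H b) (t b) (FAr G a b f)) (s a)"
      unfolding sn[OF a b f]
      using F.tgt.Cmp_assoc[OF _ _ _ _ sh[OF a] ar(2) th[OF b]] ob a b by simp
    also have "\<dots> = Cmp D (FOb F a) (FOb H a) (FOb H b) (FAr H a b f) (?r a)"
      unfolding tn[OF a b f]
      using F.tgt.Cmp_assoc[OF _ _ _ _ sh[OF a] th[OF a] ar(3)] ob a b by simp
    finally show "Cmp D (FOb F a) (FOb F b) (FOb H b) (?r b) (FAr F a b f)
      = Cmp D (FOb F a) (FOb H a) (FOb H b) (FAr H a b f) (?r a)" .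
  qed
qed

lemma naturally_isomorphic_whisker:
  assumes "cat_functor C D F" and iso: "naturally_isomorphic D E G H"
  shows "naturally_isomorphic C E (fctr_comp C G F) (fctr_comp C H F)"
proof -
  interpret F: cat_functor C D F by fact
  obtain s where "\<forall>a \<in> Ob D. is_iso E (FOb G a) (FOb H a) (s a)"
    and "\<forall>a \<in> Ob D. \<forall>b \<in> Ob D. \<forall>f \<in> Hom D a b.
      Cmp E (FOb G a) (FOb G b) (FOb H b) (s b) (FAr G a b f)
        = Cmp E (FOb G a) (FOb H a) (FOb H b) (FAr H a b f) (s a)"
    using iso unfolding naturally_isomorphic_def by blast
  then show ?thesis
    unfolding naturally_isomorphic_def
    by (intro exI[of _ "\<lambda>a. s (FOb F a)"])
      (auto simp: fctr_comp_def F.FOb_in_Ob F.FAr_in_Hom)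
qed

lemma Partial_order_refl: "\<lbrakk>Partial_order P; x \<in> Field P\<rbrakk> \<Longrightarrow> (x, x) \<in> P"
  by (auto simp: order_on_defs refl_on_def)

lemma Partial_order_trans: "\<lbrakk>Partial_order P; (x, y) \<in> P; (y, z) \<in> P\<rbrakk> \<Longrightarrow> (x, z) \<in> P"
  by (auto simp: order_on_defs dest: transD)

lemma Partial_order_antisym: "\<lbrakk>Partial_order P; (x, y) \<in> P; (y, x) \<in> P\<rbrakk> \<Longrightarrow> x = y"
  by (auto simp: order_on_defs dest: antisymD)

lemma category_poset_cat:
  assumes "Partial_order P"
  shows "category (poset_cat P)"
  by unfold_locales
    (use assms in \<open>auto simp: poset_cat_def Partial_order_refl split: if_splits
      intro: Partial_order_trans\<close>)

lemma Ob_poset_cat [simp]: "Ob (poset_cat P) = Field P"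
  and Hom_poset_cat [simp]: "f \<in> Hom (poset_cat P) a b \<longleftrightarrow> (a, b) \<in> P"
  by (auto simp: poset_cat_def)

lemma order_preserving_closed: "\<lbrakk>f \<in> order_preserving P Q; x \<in> Field P\<rbrakk> \<Longrightarrow> f x \<in> Field Q"
  by (auto simp: order_preserving_def)

lemma order_preserving_mono: "\<lbrakk>f \<in> order_preserving P Q; (x, y) \<in> P\<rbrakk> \<Longrightarrow> (f x, f y) \<in> Q"
  unfolding order_preserving_def monotone_on_def by (blast intro: FieldI1 FieldI2)

lemma order_preserving_extensional: "f \<in> order_preserving P Q \<Longrightarrow> f \<in> extensional (Field P)"
  by (auto simp: order_preserving_def PiE_def)

lemma order_preservingI:
  assumes "f \<in> extensional (Field P)" "\<And>x. x \<in> Field P \<Longrightarrow> f x \<in> Field Q"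
    and "\<And>x y. (x, y) \<in> P \<Longrightarrow> (f x, f y) \<in> Q"
  shows "f \<in> order_preserving P Q"
  using assms by (auto simp: order_preserving_def monotone_on_def PiE_iff)

lemma order_preserving_id: "(\<lambda>x \<in> Field P. x) \<in> order_preserving P P"
  by (rule order_preservingI) (auto intro: FieldI1 FieldI2)

lemma order_preserving_compose:
  assumes "f \<in> order_preserving P Q" "g \<in> order_preserving Q R"
  shows "compose (Field P) g f \<in> order_preserving P R"
  using assms
  by (intro order_preservingI)
    (auto simp: compose_def FieldI1 FieldI2 order_preserving_closed order_preserving_mono)

lemma compose_restrict_id:
  assumes "f \<in> order_preserving P Q"
  shows "compose (Field P) (\<lambda>x \<in> Field Q. x) f = f" "compose (Field P) f (\<lambda>x \<in> Field P. x) = f"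
  using assms order_preserving_extensional[OF assms]
  by (auto simp: compose_def fun_eq_iff order_preserving_closed extensional_def)

lemma order_preserving_compose_assoc:
  assumes "f \<in> order_preserving P Q"
  shows "compose (Field P) h (compose (Field P) g f) = compose (Field P) (compose (Field Q) h g) f"
  using assms by (auto simp: compose_def fun_eq_iff order_preserving_closed)

lemma cat_functor_map_fctr:
  assumes "Partial_order P" "Partial_order Q" "f \<in> order_preserving P Q"
  shows "cat_functor (poset_cat P) (poset_cat Q) (map_fctr P f)"
proof -
  interpret P: category "poset_cat P" by (rule category_poset_cat) fact
  interpret Q: category "poset_cat Q" by (rule category_poset_cat) fact
  show ?thesis
    by unfold_locales
      (use assms in \<open>auto simp: map_fctr_def FieldI1 FieldI2 order_preserving_closed
        order_preserving_mono\<close>)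
qed

lemma fctr_comp_map_fctr_id:
  assumes "cat_functor (poset_cat P) D M"
  shows "fctr_comp (poset_cat P) M (map_fctr P (\<lambda>x \<in> Field P. x)) = M"
proof -
  interpret M: cat_functor "poset_cat P" D M by fact
  have "FOb (fctr_comp (poset_cat P) M (map_fctr P (\<lambda>x \<in> Field P. x))) = FOb M"
    by (auto simp: fctr_comp_def map_fctr_def fun_eq_iff M.FOb_ext)
  moreover have "FAr (fctr_comp (poset_cat P) M (map_fctr P (\<lambda>x \<in> Field P. x))) = FAr M"
    by (auto simp: fctr_comp_def map_fctr_def fun_eq_iff M.FAr_ext)
  ultimately show ?thesis
    by (intro fctr.equality) auto
qed

lemma map_fctr_compose:
  assumes "g \<in> order_preserving R Q"
  shows "fctr_comp (poset_cat R) (map_fctr Q f) (map_fctr R g) = map_fctr R (compose (Field R) f g)"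
  using assms
  by (auto simp: fctr_comp_def map_fctr_def compose_def fun_eq_iff order_preserving_closed)


section \<open>Vector spaces and the dimension of a kernel\<close>

lemma linear_map_iff:
  "linear_map K V W T \<longleftrightarrow> vectorspace K V \<and> vectorspace K W \<and> T \<in> module_hom K V W"
  by (auto simp: linear_map_def mod_hom_def mod_hom_axioms_def vectorspace_def)

lemma linear_map_id:
  assumes "vectorspace K V"
  shows "linear_map K V V (\<lambda>v \<in> carrier V. v)"
proof -
  interpret vectorspace K V by fact
  show ?thesis
    using assms by (auto simp: linear_map_iff module_hom_def)
qed

lemma linear_map_compose:
  assumes "linear_map K U V T" "linear_map K V W S"
  shows "linear_map K U W (compose (carrier U) S T)"
proof -
  interpret T: linear_map K U V T by fact
  interpret S: linear_map K V W S by fact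
  show ?thesis
    using assms by (auto simp: linear_map_iff module_hom_def compose_def)
qed

lemma category_vec_cat:
  fixes K :: "('a, 'b) ring_scheme"
  shows "category (vec_cat K :: (('a, 'c) module, 'c \<Rightarrow> 'c) cat)"
proof unfold_locales
  fix V :: "('a, 'c) module"
  assume "V \<in> Ob (vec_cat K)"
  then show "Idn (vec_cat K) V \<in> Hom (vec_cat K) V V"
    by (simp add: vec_cat_def linear_map_id)
next
  fix U V W :: "('a, 'c) module" and T S
  assume "T \<in> Hom (vec_cat K) U V" "S \<in> Hom (vec_cat K) V W"
  then show "Cmp (vec_cat K) U V W S T \<in> Hom (vec_cat K) U W"
    by (auto simp: vec_cat_def intro: linear_map_compose)
next
  fix V W :: "('a, 'c) module" and T
  assume "T \<in> Hom (vec_cat K) V W"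
  then have T: "T \<in> extensional (carrier V)" "T \<in> carrier V \<rightarrow> carrier W"
    by (auto simp: vec_cat_def linear_map_iff module_hom_def)
  then show "Cmp (vec_cat K) V W W (Idn (vec_cat K) W) T = T"
    by (simp add: vec_cat_def Id_compose)
  show "Cmp (vec_cat K) V V W T (Idn (vec_cat K) V) = T"
    using T by (simp add: vec_cat_def compose_Id)
next
  fix U V W X :: "('a, 'c) module" and R S T
  assume "R \<in> Hom (vec_cat K) U V"
  then have "R \<in> carrier U \<rightarrow> carrier V"
    by (auto simp: vec_cat_def linear_map_iff module_hom_def)
  then show "Cmp (vec_cat K) U W X T (Cmp (vec_cat K) U V W S R)
      = Cmp (vec_cat K) U V X (Cmp (vec_cat K) V W X T S) R"
    by (simp add: vec_cat_def compose_assoc)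
qed

text \<open>
  Both kernels are compared with that of the diagonal of the square. As \<open>t\<close> is injective, the
  diagonal has the kernel of \<open>T\<close>, and as \<open>s\<close> is surjective, it has the image of
  \<open>T'\<close>. Rank-nullity for the diagonal and for \<open>T'\<close> then gives the equality, because
  \<open>V\<close> and \<open>V'\<close> have the same dimension.
\<close>

lemma dim_ker_iso_invariant:
  assumes s: "is_iso (vec_cat K) V V' s" and t: "is_iso (vec_cat K) W W' t"
    and ob: "V \<in> Ob (vec_cat K)" "V' \<in> Ob (vec_cat K)"
    and T: "T \<in> Hom (vec_cat K) V W" and T': "T' \<in> Hom (vec_cat K) V' W'"
    and square: "Cmp (vec_cat K) V W W' t T = Cmp (vec_cat K) V V' W' T' s"
  shows "vectorspace.dim K (V\<lparr>carrier := mod_hom.ker V W T\<rparr>)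
    = vectorspace.dim K (V'\<lparr>carrier := mod_hom.ker V' W' T'\<rparr>)"
proof -
  obtain s' where sl: "linear_map K V V' s" and s'l: "linear_map K V' V s'"
    and s's: "compose (carrier V) s' s = (\<lambda>v \<in> carrier V. v)"
    and ss': "compose (carrier V') s s' = (\<lambda>v \<in> carrier V'. v)"
    using s by (auto simp: is_iso_def vec_cat_def)
  obtain t' where tl: "linear_map K W W' t" and t'l: "linear_map K W' W t'"
    and t't: "compose (carrier W) t' t = (\<lambda>v \<in> carrier W. v)"
    using t by (auto simp: is_iso_def vec_cat_def)
  have Tl: "linear_map K V W T" and T'l: "linear_map K V' W' T'"
    using T T' by (auto simp: vec_cat_def)
  interpret s: linear_map K V V' s by fact
  interpret s': linear_map K V' V s' by fact
  interpret t: linear_map K W W' t by fact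
  interpret T: linear_map K V W T by fact
  interpret T': linear_map K V' W' T' by fact
  let ?D = "compose (carrier V) T' s"
  interpret D: linear_map K V W' ?D
    by (rule linear_map_compose[OF sl T'l])
  have fd: "s.V.fin_dim" "s.W.fin_dim"
    using ob by (auto simp: vec_cat_def)
  have inv: "\<And>v. v \<in> carrier V \<Longrightarrow> s' (s v) = v" "\<And>v. v \<in> carrier V' \<Longrightarrow> s (s' v) = v"
    "\<And>w. w \<in> carrier W \<Longrightarrow> t' (t w) = w"
    using s's ss' t't by (auto simp: compose_def fun_eq_iff) metis+
  have D: "?D v = t (T v)" if "v \<in> carrier V" for v
    using square that by (auto simp: vec_cat_def compose_def fun_eq_iff) metis
  have t0: "t w = \<zero>\<^bsub>W'\<^esub> \<longleftrightarrow> w = \<zero>\<^bsub>W\<^esub>" if "w \<in> carrier W" for w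
    using inv(3)[OF that] inv(3)[of "\<zero>\<^bsub>W\<^esub>"] by auto
  have surj: "s ` carrier V = carrier V'"
    using inv(2) by (force intro!: image_eqI[where x = "s' _"])
  have "s.V.dim = s.W.dim"
  proof (rule s.dim_eq[OF fd(1) _ surj])
    show "inj_on s (carrier V)"
      by (rule inj_on_inverseI[of _ s']) (rule inv(1))
  qed
  moreover have "D.kerT = T.kerT"
    unfolding D.ker_def T.ker_def using D t0 by auto
  moreover have "D.imT = T'.imT"
    unfolding D.im_def T'.im_def unfolding surj[symmetric] image_image
    by (simp add: compose_def)
  ultimately show ?thesis
    using D.rank_nullity[OF fd(1)] T'.rank_nullity[OF fd(2)] by simp
qed


section \<open>The category of persistence modules\<close>

lemma galois_insertion_id: "galois_insertion P P (\<lambda>x \<in> Field P. x) (\<lambda>x \<in> Field P. x)"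
  by (simp add: galois_insertion_def order_preserving_id)

lemma galois_insertion_compose:
  assumes "galois_insertion P Q f g" "galois_insertion Q R f' g'"
  shows "galois_insertion P R (compose (Field P) f' f) (compose (Field R) g g')"
proof -
  have op: "f \<in> order_preserving P Q" "g \<in> order_preserving Q P"
    "f' \<in> order_preserving Q R" "g' \<in> order_preserving R Q"
    using assms by (auto simp: galois_insertion_def)
  have "compose (Field P) f' f \<in> order_preserving P R"
    "compose (Field R) g g' \<in> order_preserving R P"
    using op by (auto intro: order_preserving_compose)
  then show ?thesis
    using assms op[THEN order_preserving_closed] by (auto simp: galois_insertion_def compose_eq)
qed

lemma Ob_PMod: "(P, M) \<in> Ob (PMod K) \<longleftrightarrow>
    Partial_order P \<and> cat_functor (poset_cat P) (vec_cat K) M"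
  by (simp add: PMod_def)

lemma Hom_PMod: "(f, g) \<in> Hom (PMod K) (P, M) (Q, N) \<longleftrightarrow>
    galois_insertion P Q f g \<and> naturally_isomorphic (poset_cat Q) (vec_cat K)
      (fctr_comp (poset_cat Q) M (map_fctr Q g)) N"
  by (simp add: PMod_def)

lemma Idn_PMod: "Idn (PMod K) (P, M) = (\<lambda>x \<in> Field P. x, \<lambda>x \<in> Field P. x)"
  by (simp add: PMod_def)

lemma Cmp_PMod: "Cmp (PMod K) (P, L) (Q, M) (R, N) (f', g') (f, g)
    = (compose (Field P) f' f, compose (Field R) g g')"
  by (simp add: PMod_def)

text \<open>
  With \<open>L \<circ> g \<cong> M\<close> and \<open>M \<circ> g' \<cong> N\<close>, whiskering the first
  isomorphism with \<open>g'\<close> gives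
  \<open>L \<circ> (g \<circ> g') \<cong> M \<circ> g' \<cong> N\<close>.
\<close>

lemma PMod_Cmp_in_Hom:
  assumes ob: "(P, L) \<in> Ob (PMod K)" "(Q, M) \<in> Ob (PMod K)" "(R, N) \<in> Ob (PMod K)"
    and fg: "(f, g) \<in> Hom (PMod K) (P, L) (Q, M)"
    and fg': "(f', g') \<in> Hom (PMod K) (Q, M) (R, N)"
  shows "(compose (Field P) f' f, compose (Field R) g g') \<in> Hom (PMod K) (P, L) (R, N)"
proof -
  let ?L = "fctr_comp (poset_cat Q) L (map_fctr Q g)"
  have g: "cat_functor (poset_cat Q) (poset_cat P) (map_fctr Q g)"
    and g': "cat_functor (poset_cat R) (poset_cat Q) (map_fctr R g')"
    and op': "g' \<in> order_preserving R Q"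
    using ob fg fg' by (auto simp: Ob_PMod Hom_PMod galois_insertion_def intro: cat_functor_map_fctr)
  have L: "cat_functor (poset_cat P) (vec_cat K) L" and M: "cat_functor (poset_cat Q) (vec_cat K) M"
    and N: "cat_functor (poset_cat R) (vec_cat K) N"
    using ob by (auto simp: Ob_PMod)
  note Lg = cat_functor_fctr_comp[OF g L]
  have "naturally_isomorphic (poset_cat R) (vec_cat K)
      (fctr_comp (poset_cat R) ?L (map_fctr R g')) (fctr_comp (poset_cat R) M (map_fctr R g'))"
    using fg by (intro naturally_isomorphic_whisker[OF g']) (auto simp: Hom_PMod)
  moreover have "naturally_isomorphic (poset_cat R) (vec_cat K)
      (fctr_comp (poset_cat R) M (map_fctr R g')) N"
    using fg' by (auto simp: Hom_PMod)
  ultimately have "naturally_isomorphic (poset_cat R) (vec_cat K)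
      (fctr_comp (poset_cat R) ?L (map_fctr R g')) N"
    by (rule naturally_isomorphic_trans[OF cat_functor_fctr_comp[OF g' Lg]
        cat_functor_fctr_comp[OF g' M] N])
  then show ?thesis
    using fg fg' galois_insertion_compose[of P Q f g R f' g']
    by (simp add: Hom_PMod fctr_comp_assoc[OF g'] map_fctr_compose[OF op'])
qed

lemma category_PMod: "category (PMod K)"
proof unfold_locales
  fix X assume "X \<in> Ob (PMod K)"
  then show "Idn (PMod K) X \<in> Hom (PMod K) X X"
    by (cases X) (auto simp: Ob_PMod Hom_PMod Idn_PMod galois_insertion_id fctr_comp_map_fctr_id
        naturally_isomorphic_refl)
next
  fix X Y Z F G
  assume "X \<in> Ob (PMod K)" "Y \<in> Ob (PMod K)" "Z \<in> Ob (PMod K)"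
    "F \<in> Hom (PMod K) X Y" "G \<in> Hom (PMod K) Y Z"
  then show "Cmp (PMod K) X Y Z G F \<in> Hom (PMod K) X Z"
    by (cases X; cases Y; cases Z; cases F; cases G) (auto simp: Cmp_PMod PMod_Cmp_in_Hom)
next
  fix X Y F
  assume "F \<in> Hom (PMod K) X Y"
  then show "Cmp (PMod K) X Y Y (Idn (PMod K) Y) F = F" "Cmp (PMod K) X X Y F (Idn (PMod K) X) = F"
    by (cases X; cases Y; cases F;
        auto simp: Cmp_PMod Idn_PMod Hom_PMod galois_insertion_def compose_restrict_id)+
next
  fix X Y Z W F G H
  assume "F \<in> Hom (PMod K) X Y" "G \<in> Hom (PMod K) Y Z" "H \<in> Hom (PMod K) Z W"
  then show "Cmp (PMod K) X Z W H (Cmp (PMod K) X Y Z G F)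
      = Cmp (PMod K) X Y W (Cmp (PMod K) Y Z W H G) F"
    by (cases X; cases Y; cases Z; cases W; cases F; cases G; cases H)
      (auto simp: Cmp_PMod Hom_PMod galois_insertion_def order_preserving_compose_assoc)
qed


section \<open>Pushforwards and the category of persistence diagrams\<close>

text \<open>
  Only the values of the intermediate pushforward on the fibre of \<open>k\<close> over \<open>c\<close>
  enter. This locality is what makes diagrams compose although their morphisms ignore the diagonal.
\<close>

lemma pushforward_comp:
  assumes fin: "finite {a \<in> A. m a \<noteq> 0}" and h: "\<And>a. a \<in> A \<Longrightarrow> h a \<in> B"
    and l: "\<And>a. a \<in> A \<Longrightarrow> l a = k (h a)"
    and w: "\<And>b. \<lbrakk>b \<in> B; k b = c\<rbrakk> \<Longrightarrow> pushforward A h m b = w b"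
  shows "pushforward A l m c = pushforward B k w c"
proof -
  let ?T = "{a \<in> A. l a = c \<and> m a \<noteq> 0}"
  have finT: "finite ?T"
    using fin by (rule rev_finite_subset) auto
  have fibre: "(\<Sum>a \<in> {a \<in> ?T. h a = b}. m a) = w b" if "b \<in> B" "k b = c" for b
  proof -
    have "{a \<in> ?T. h a = b} = {a \<in> A. h a = b \<and> m a \<noteq> 0}"
      using l that by auto
    then show ?thesis
      using w[OF that] by (simp add: pushforward_def)
  qed
  have "pushforward A l m c = (\<Sum>b \<in> h ` ?T. \<Sum>a \<in> {a \<in> ?T. h a = b}. m a)"
    unfolding pushforward_def by (rule sum.image_gen[OF finT])
  also have "\<dots> = (\<Sum>b \<in> h ` ?T. w b)"
    by (rule sum.cong[OF refl], rule fibre) (use h l in auto)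
  also have "\<dots> = (\<Sum>b \<in> {b \<in> B. k b = c \<and> w b \<noteq> 0}. w b)"
  proof (rule sum.mono_neutral_right)
    show "{b \<in> B. k b = c \<and> w b \<noteq> 0} \<subseteq> h ` ?T"
    proof
      fix b assume b: "b \<in> {b \<in> B. k b = c \<and> w b \<noteq> 0}"
      then have "(\<Sum>a \<in> {a \<in> ?T. h a = b}. m a) \<noteq> 0"
        using fibre by auto
      then have "{a \<in> ?T. h a = b} \<noteq> {}"
        by (rule contrapos_nn) (simp only: sum.empty)
      then show "b \<in> h ` ?T"
        by blast
    qed
  qed (use finT h l in auto)
  finally show ?thesis
    by (simp add: pushforward_def)
qed

lemma pushforward_id:
  assumes "\<And>a. a \<in> A \<Longrightarrow> h a = a" "b \<in> A"
  shows "pushforward A h m b = m b"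
proof -
  have "{a \<in> A. h a = b \<and> m a \<noteq> 0} = (if m b = 0 then {} else {b})"
    using assms by auto
  then show ?thesis
    by (simp add: pushforward_def)
qed

lemma Ob_Dgm: "(P, w) \<in> Ob Dgm \<longleftrightarrow> Partial_order P \<and> w \<in> extensional (Field (bar_poset P)) \<and>
    finite {x \<in> Field (bar_poset P). w x \<noteq> 0}"
  by (simp add: Dgm_def)

lemma Hom_Dgm: "f \<in> Hom Dgm (P, w) (Q, w') \<longleftrightarrow> f \<in> order_preserving P Q \<and>
    (\<forall>y \<in> off_diagonal Q. pushforward (Field (bar_poset P)) (map_prod f f) w y = w' y)"
  by (simp add: Dgm_def)

lemma Idn_Dgm: "Idn Dgm (P, w) = (\<lambda>x \<in> Field P. x)"
  by (simp add: Dgm_def)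

lemma Cmp_Dgm: "Cmp Dgm (P, w) Y Z g f = compose (Field P) g f"
  by (simp add: Dgm_def)

lemma Dgm_Cmp_in_Hom:
  assumes ob: "(P, u) \<in> Ob Dgm" "(Q, v) \<in> Ob Dgm"
    and f: "f \<in> Hom Dgm (P, u) (Q, v)" and g: "g \<in> Hom Dgm (Q, v) (R, w)"
  shows "compose (Field P) g f \<in> Hom Dgm (P, u) (R, w)"
proof -
  have P: "Field (bar_poset P) = P" and Q: "Field (bar_poset Q) = Q"
    using ob by (auto simp: Ob_Dgm Field_bar_poset)
  have fo: "f \<in> order_preserving P Q" and go: "g \<in> order_preserving Q R"
    using f g by (auto simp: Hom_Dgm)
  have "pushforward P (map_prod (compose (Field P) g f) (compose (Field P) g f)) u z = w z"
    if z: "z \<in> off_diagonal R" for z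
  proof -
    have "pushforward P (map_prod (compose (Field P) g f) (compose (Field P) g f)) u z
      = pushforward Q (map_prod g g) v z"
    proof (rule pushforward_comp)
      show "finite {x \<in> P. u x \<noteq> 0}"
        using ob P by (simp add: Ob_Dgm)
      show "map_prod f f x \<in> Q" if "x \<in> P" for x
        using that order_preserving_mono[OF fo] by (cases x) auto
      show "map_prod (compose (Field P) g f) (compose (Field P) g f) x
        = map_prod g g (map_prod f f x)" if "x \<in> P" for x
        using that by (cases x) (auto simp: compose_eq FieldI1 FieldI2)
      show "pushforward P (map_prod f f) u y = v y" if y: "y \<in> Q" "map_prod g g y = z" for y
      proof -
        \<comment> \<open>An order-preserving map sends the diagonal to the diagonal, so \<open>y\<close> is off it.\<close>
        have "y \<in> off_diagonal Q"
          using y z order_preserving_closed[OF go] Q by (auto simp: off_diagonal_def)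
        then show ?thesis
          using f P by (simp add: Hom_Dgm)
      qed
    qed
    then show ?thesis
      using g z Q by (simp add: Hom_Dgm)
  qed
  then show ?thesis
    using order_preserving_compose[OF fo go] P by (simp add: Hom_Dgm)
qed

lemma category_Dgm: "category Dgm"
proof unfold_locales
  fix X :: "'a diagram" assume "X \<in> Ob Dgm"
  obtain P w where X: "X = (P, w)"
    by (cases X)
  then have P: "Field (bar_poset P) = P"
    using \<open>X \<in> Ob Dgm\<close> by (auto simp: Ob_Dgm Field_bar_poset)
  have "pushforward P (map_prod (\<lambda>x \<in> Field P. x) (\<lambda>x \<in> Field P. x)) w y = w y" if "y \<in> P" for y
    using that by (intro pushforward_id) (auto simp: FieldI1 FieldI2)
  then show "Idn Dgm X \<in> Hom Dgm X X"
    using P by (simp add: X Idn_Dgm Hom_Dgm order_preserving_id off_diagonal_def)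
next
  fix X Y Z :: "'a diagram" and f g
  assume "X \<in> Ob Dgm" "Y \<in> Ob Dgm" "Z \<in> Ob Dgm" "f \<in> Hom Dgm X Y" "g \<in> Hom Dgm Y Z"
  then show "Cmp Dgm X Y Z g f \<in> Hom Dgm X Z"
    by (cases X; cases Y; cases Z) (auto simp: Cmp_Dgm Dgm_Cmp_in_Hom)
next
  fix X Y :: "'a diagram" and f
  assume "f \<in> Hom Dgm X Y"
  then show "Cmp Dgm X Y Y (Idn Dgm Y) f = f" "Cmp Dgm X X Y f (Idn Dgm X) = f"
    by (cases X; cases Y; auto simp: Cmp_Dgm Idn_Dgm Hom_Dgm compose_restrict_id)+
next
  fix X Y Z W :: "'a diagram" and f g h
  assume "f \<in> Hom Dgm X Y"
  then show "Cmp Dgm X Z W h (Cmp Dgm X Y Z g f) = Cmp Dgm X Y W (Cmp Dgm Y Z W h g) f"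
    by (cases X; cases Y) (auto simp: Cmp_Dgm Hom_Dgm order_preserving_compose_assoc)
qed


section \<open>Moebius inversion along Galois connections\<close>

text \<open>
  Rota's Galois connection theorem. By the adjunction the down-set of \<open>y\<close> pulls back
  along \<open>f\<close> to the down-set of \<open>g y\<close>, so that summing the pushforward below
  \<open>y\<close> is summing \<open>d\<close> below \<open>g y\<close>.
\<close>

lemma moebius_inversion_pushforward:
  assumes d: "moebius_inversion X m d" and fin: "finite {x \<in> Field X. d x \<noteq> 0}"
    and f: "\<And>x. x \<in> Field X \<Longrightarrow> f x \<in> Field Y" and g: "\<And>y. y \<in> Field Y \<Longrightarrow> g y \<in> Field X"
    and adj: "\<And>x y. \<lbrakk>x \<in> Field X; y \<in> Field Y\<rbrakk> \<Longrightarrow> (f x, y) \<in> Y \<longleftrightarrow> (x, g y) \<in> X"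
    and m': "\<And>y. y \<in> Field Y \<Longrightarrow> m' y = m (g y)"
  shows "moebius_inversion Y m' (restrict (pushforward (Field X) f d) (Field Y))"
    and "finite {y \<in> Field Y. restrict (pushforward (Field X) f d) (Field Y) y \<noteq> 0}"
proof -
  let ?S = "{x \<in> Field X. d x \<noteq> 0}"
  let ?D = "restrict (pushforward (Field X) f d) (Field Y)"
  have supp: "z \<in> f ` ?S" if "z \<in> Field Y" "?D z \<noteq> 0" for z
  proof -
    have "(\<Sum>x \<in> {x \<in> Field X. f x = z \<and> d x \<noteq> 0}. d x) \<noteq> 0"
      using that by (simp add: pushforward_def)
    then have "{x \<in> Field X. f x = z \<and> d x \<noteq> 0} \<noteq> {}"
      by (rule contrapos_nn) (simp only: sum.empty)
    then show ?thesis
      by blast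
  qed
  then show finD: "finite {y \<in> Field Y. ?D y \<noteq> 0}"
    using fin by (intro finite_subset[OF _ finite_imageI[of ?S f]]) auto
  have "m' y = (\<Sum>z \<in> {z. (z, y) \<in> Y \<and> ?D z \<noteq> 0}. ?D z)" if y: "y \<in> Field Y" for y
  proof -
    let ?T = "{x \<in> ?S. (f x, y) \<in> Y}"
    have finT: "finite ?T"
      by (rule rev_finite_subset[OF fin]) auto
    have fibre: "(\<Sum>x \<in> {x \<in> ?T. f x = z}. d x) = ?D z" if "z \<in> f ` ?T" for z
    proof -
      have "{x \<in> ?T. f x = z} = {x \<in> Field X. f x = z \<and> d x \<noteq> 0}"
        using that by auto
      then show ?thesis
        using that f by (auto simp: pushforward_def)
    qed
    have "{x. (x, g y) \<in> X \<and> d x \<noteq> 0} = ?T"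
      using adj y by (auto intro: FieldI1)
    then have "m' y = (\<Sum>x \<in> ?T. d x)"
      using d g[OF y] m'[OF y] by (simp add: moebius_inversion_def)
    also have "\<dots> = (\<Sum>z \<in> f ` ?T. \<Sum>x \<in> {x \<in> ?T. f x = z}. d x)"
      by (rule sum.image_gen[OF finT])
    also have "\<dots> = (\<Sum>z \<in> f ` ?T. ?D z)"
      by (rule sum.cong[OF refl], rule fibre)
    also have "\<dots> = (\<Sum>z \<in> {z. (z, y) \<in> Y \<and> ?D z \<noteq> 0}. ?D z)"
    proof (rule sum.mono_neutral_right)
      show "{z. (z, y) \<in> Y \<and> ?D z \<noteq> 0} \<subseteq> f ` ?T"
      proof
        fix z assume z: "z \<in> {z. (z, y) \<in> Y \<and> ?D z \<noteq> 0}"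
        then have "z \<in> f ` ?S"
          using supp[of z] FieldI1[of z y Y] by blast
        then show "z \<in> f ` ?T"
          using z by blast
      qed
    qed (use finT in auto)
    finally show ?thesis .
  qed
  moreover have "finite {z. (z, y) \<in> Y \<and> ?D z \<noteq> 0}" if "y \<in> Field Y" for y
    by (rule rev_finite_subset[OF finD]) (auto intro: FieldI1)
  ultimately show "moebius_inversion Y m' ?D"
    by (auto simp: moebius_inversion_def)
qed

text \<open>
  Moebius inversion is a triangular system of linear equations: adding a maximal element
  \<open>z\<close> to a set adds one unknown and one equation, and the new unknown does not occur in
  the old equations.
\<close>

lemma finite_moebius_system:
  assumes X: "Partial_order X" and "finite A" "A \<subseteq> Field X"
  shows "\<exists>d :: 'a \<Rightarrow> int. \<forall>y \<in> A. m y = (\<Sum>x \<in> {x \<in> A. (x, y) \<in> X}. d x)"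
  using assms(2,3)
proof (induction A rule: finite_psubset_induct)
  case (psubset A)
  show ?case
  proof (cases "A = {}")
    case False
    have "\<exists>z \<in> A. \<forall>y \<in> A. (z, y) \<in> X \<longrightarrow> y = z"
    proof -
      have "wf ((X\<inverse> - Id) \<inter> A \<times> A)"
      proof (rule finite_acyclic_wf)
        show "finite ((X\<inverse> - Id) \<inter> A \<times> A)"
          using psubset.hyps by blast
        have "trans (X\<inverse>)" "antisym (X\<inverse>)"
          using X by (auto simp: order_on_defs)
        then have "acyclic (X\<inverse> - Id)"
          by (intro acyclicI) (simp add: trancl_id trans_diff_Id)
        then show "acyclic ((X\<inverse> - Id) \<inter> A \<times> A)"
          by (rule acyclic_subset) auto
      qed
      then obtain z where "z \<in> A" "\<And>y. (y, z) \<in> (X\<inverse> - Id) \<inter> A \<times> A \<Longrightarrow> y \<notin> A"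
        using False by (metis ex_in_conv wfE_min)
      then show ?thesis
        by blast
    qed
    then obtain z where z: "z \<in> A" and maximal: "\<And>y. \<lbrakk>y \<in> A; (z, y) \<in> X\<rbrakk> \<Longrightarrow> y = z"
      by blast
    obtain d :: "'a \<Rightarrow> int" where d: "\<And>y. y \<in> A - {z} \<Longrightarrow> m y = (\<Sum>x \<in> {x \<in> A - {z}. (x, y) \<in> X}. d x)"
      using psubset.IH[of "A - {z}"] psubset.prems z by blast
    define e where "e = d(z := m z - (\<Sum>x \<in> {x \<in> A - {z}. (x, z) \<in> X}. d x))"
    have e: "(\<Sum>x \<in> {x \<in> A - {z}. (x, y) \<in> X}. e x) = (\<Sum>x \<in> {x \<in> A - {z}. (x, y) \<in> X}. d x)" for y
      by (rule sum.cong) (auto simp: e_def)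
    have "m y = (\<Sum>x \<in> {x \<in> A. (x, y) \<in> X}. e x)" if y: "y \<in> A" for y
    proof (cases "y = z")
      case True
      have "{x \<in> A. (x, z) \<in> X} = insert z {x \<in> A - {z}. (x, z) \<in> X}"
        using z Partial_order_refl[OF X, of z] psubset.prems by auto
      then have "(\<Sum>x \<in> {x \<in> A. (x, z) \<in> X}. e x)
          = e z + (\<Sum>x \<in> {x \<in> A - {z}. (x, z) \<in> X}. e x)"
        using psubset.hyps by simp
      then show ?thesis
        unfolding e by (simp add: True e_def)
    next
      case False
      then have "{x \<in> A. (x, y) \<in> X} = {x \<in> A - {z}. (x, y) \<in> X}"
        using maximal[OF y] by auto
      then show ?thesis
        using d[of y] False y e[of y] by simp
    qed
    then show ?thesis
      by blast
  qed simp
qed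

lemma finite_poset_moebius_inversion:
  assumes "Partial_order X" "finite (Field X)"
  shows "\<exists>d. moebius_inversion X m d"
proof -
  obtain d where d: "\<And>y. y \<in> Field X \<Longrightarrow> m y = (\<Sum>x \<in> {x \<in> Field X. (x, y) \<in> X}. d x)"
    using finite_moebius_system[OF assms(1,2) order_refl] by blast
  have "m y = (\<Sum>x \<in> {x. (x, y) \<in> X \<and> restrict d (Field X) x \<noteq> 0}. restrict d (Field X) x)"
    if "y \<in> Field X" for y
    unfolding d[OF that] using assms(2)
    by (intro sum.mono_neutral_cong_right) (auto intro: FieldI1)
  moreover have "finite {x. (x, y) \<in> X \<and> restrict d (Field X) x \<noteq> 0}" for y
    by (rule rev_finite_subset[OF assms(2)]) (auto intro: FieldI1)
  ultimately show ?thesis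
    by (intro exI[of _ "restrict d (Field X)"]) (auto simp: moebius_inversion_def)
qed

text \<open>
  A co-closure operator, regarded as a map onto its image, is right adjoint to the inclusion of its
  image. The inversion over the finite image is therefore pushed forward along the inclusion.
\<close>

lemma coclosure_moebius_inversion:
  assumes X: "Partial_order X" and c: "coclosure_operator X c" and fin: "finite (c ` Field X)"
    and m: "\<And>y. y \<in> Field X \<Longrightarrow> m y = m (c y)"
  shows "\<exists>d. moebius_inversion X m d \<and> finite {x \<in> Field X. d x \<noteq> 0}"
proof -
  let ?S = "c ` Field X"
  have co: "c \<in> order_preserving X X" and below: "\<And>x. x \<in> Field X \<Longrightarrow> (c x, x) \<in> X"
    and idem: "\<And>x. x \<in> Field X \<Longrightarrow> c (c x) = c x"
    using c by (auto simp: coclosure_operator_def)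
  have S: "?S \<subseteq> Field X"
    using order_preserving_closed[OF co] by auto
  define Y where "Y = Restr X ?S"
  have FY: "Field Y = ?S"
  proof
    show "Field Y \<subseteq> ?S"
      by (auto simp: Y_def Field_def)
    show "?S \<subseteq> Field Y"
    proof
      fix s assume "s \<in> ?S"
      then have "(s, s) \<in> Y"
        using S Partial_order_refl[OF X] by (auto simp: Y_def)
      then show "s \<in> Field Y"
        by (rule FieldI1)
    qed
  qed
  have Y: "Partial_order Y"
    unfolding Y_def by (rule Partial_order_Restr[OF X])
  obtain d where d: "moebius_inversion Y m d"
    using finite_poset_moebius_inversion[OF Y, of m] fin FY by auto
  have adj: "(x, y) \<in> X \<longleftrightarrow> (x, c y) \<in> Y" if x: "x \<in> Field Y" and y: "y \<in> Field X" for x y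
  proof
    assume "(x, y) \<in> X"
    then have "(c x, c y) \<in> X"
      by (rule order_preserving_mono[OF co])
    moreover have "c x = x"
      using x FY idem by auto
    ultimately show "(x, c y) \<in> Y"
      using x y FY by (auto simp: Y_def)
  next
    assume "(x, c y) \<in> Y"
    then show "(x, y) \<in> X"
      using below[OF y] by (auto simp: Y_def intro: Partial_order_trans[OF X])
  qed
  have "finite {x \<in> Field Y. d x \<noteq> 0}"
    using fin FY by simp
  note push = moebius_inversion_pushforward[OF d this, of "\<lambda>x. x" X c m, OF _ _ adj m]
  show ?thesis
    using push S FY by blast
qed


section \<open>The nullity function on the poset of pairs\<close>

lemma nullity_naturally_isomorphic:
  assumes P: "Partial_order P" and "cat_functor (poset_cat P) (vec_cat K) M"
    and "cat_functor (poset_cat P) (vec_cat K) N"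
    and iso: "naturally_isomorphic (poset_cat P) (vec_cat K) M N"
  shows "nullity K (P, M) = nullity K (P, N)"
proof -
  interpret M: cat_functor "poset_cat P" "vec_cat K" M by fact
  interpret N: cat_functor "poset_cat P" "vec_cat K" N by fact
  obtain s where s: "\<And>a. a \<in> Field P \<Longrightarrow> is_iso (vec_cat K) (FOb M a) (FOb N a) (s a)"
    and sn: "\<And>a b f. \<lbrakk>a \<in> Field P; b \<in> Field P; f \<in> Hom (poset_cat P) a b\<rbrakk> \<Longrightarrow>
      Cmp (vec_cat K) (FOb M a) (FOb M b) (FOb N b) (s b) (FAr M a b f)
        = Cmp (vec_cat K) (FOb M a) (FOb N a) (FOb N b) (FAr N a b f) (s a)"
    using iso unfolding naturally_isomorphic_def Ob_poset_cat by blast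
  have nat: "Cmp (vec_cat K) (FOb M a) (FOb M b) (FOb N b) (s b) (FAr M a b ())
        = Cmp (vec_cat K) (FOb M a) (FOb N a) (FOb N b) (FAr N a b ()) (s a)" if "(a, b) \<in> P" for a b
    using that by (intro sn) (auto simp: FieldI1 FieldI2)
  have "vectorspace.dim K ((FOb M a)\<lparr>carrier := mod_hom.ker (FOb M a) (FOb M b) (FAr M a b ())\<rparr>)
    = vectorspace.dim K ((FOb N a)\<lparr>carrier := mod_hom.ker (FOb N a) (FOb N b) (FAr N a b ())\<rparr>)"
    if ab: "(a, b) \<in> P" for a b
    using FieldI1[OF ab] FieldI2[OF ab] ab
    by (intro dim_ker_iso_invariant[OF s s _ _ _ _ nat] M.FOb_in_Ob N.FOb_in_Ob
        M.FAr_in_Hom N.FAr_in_Hom) auto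
  then show ?thesis
    by (auto simp: nullity_def Field_bar_poset[OF P] fun_eq_iff)
qed

text \<open>
  Both the morphisms of persistence modules and constructibility are conditions of the form
  \<open>M \<circ> g \<cong> N\<close>; this is the form in which they act on nullities.
\<close>

lemma nullity_reparametrised:
  assumes P: "Partial_order P" and Q: "Partial_order Q" and g: "g \<in> order_preserving Q P"
    and M: "cat_functor (poset_cat P) (vec_cat K) M"
    and N: "cat_functor (poset_cat Q) (vec_cat K) N"
    and iso: "naturally_isomorphic (poset_cat Q) (vec_cat K)
      (fctr_comp (poset_cat Q) M (map_fctr Q g)) N"
    and y: "y \<in> Q"
  shows "nullity K (Q, N) y = nullity K (P, M) (map_prod g g y)"
proof -
  have "nullity K (Q, N) = nullity K (Q, fctr_comp (poset_cat Q) M (map_fctr Q g))"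
    by (intro nullity_naturally_isomorphic[symmetric] Q N iso
        cat_functor_fctr_comp[OF cat_functor_map_fctr[OF Q P g] M])
  moreover obtain a b where "y = (a, b)" "(a, b) \<in> Q"
    using y by (cases y) auto
  ultimately show ?thesis
    using order_preserving_mono[OF g, of a b]
    by (simp add: nullity_def Field_bar_poset P Q fctr_comp_def map_fctr_def FieldI1 FieldI2)
qed

lemma bar_poset_iff: "((a, b), (c, d)) \<in> bar_poset P \<longleftrightarrow>
    (a, b) \<in> P \<and> (c, d) \<in> P \<and> (a, c) \<in> P \<and> (b, d) \<in> P"
  by (auto simp: bar_poset_def)

lemma Partial_order_bar_poset:
  assumes P: "Partial_order P"
  shows "Partial_order (bar_poset P)"
proof -
  have "refl_on P (bar_poset P)"
    using P by (auto simp: refl_on_def bar_poset_def Partial_order_refl FieldI1 FieldI2)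
  moreover have "bar_poset P \<subseteq> P \<times> P"
    by (auto simp: bar_poset_def)
  moreover have "trans (bar_poset P)"
    unfolding bar_poset_def by (rule transI) (auto intro: Partial_order_trans[OF P])
  moreover have "antisym (bar_poset P)"
    unfolding bar_poset_def by (rule antisymI) (auto intro: Partial_order_antisym[OF P])
  ultimately show ?thesis
    by (simp add: order_on_defs Field_bar_poset[OF P])
qed

lemma coclosure_operator_bar_poset:
  assumes P: "Partial_order P" and c: "coclosure_operator P c"
  shows "coclosure_operator (bar_poset P) (restrict (map_prod c c) P)"
proof -
  have co: "c \<in> order_preserving P P" and below: "\<And>x. x \<in> Field P \<Longrightarrow> (c x, x) \<in> P"
    and idem: "\<And>x. x \<in> Field P \<Longrightarrow> c (c x) = c x"
    using c by (auto simp: coclosure_operator_def)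
  note mono = order_preserving_mono[OF co]
  have "restrict (map_prod c c) P \<in> order_preserving (bar_poset P) (bar_poset P)"
    using mono by (intro order_preservingI) (auto simp: Field_bar_poset[OF P] bar_poset_iff)
  then show ?thesis
    using mono below idem
    by (auto simp: coclosure_operator_def Field_bar_poset[OF P] bar_poset_iff FieldI1 FieldI2)
qed

lemma nullity_moebius_inversion:
  assumes M: "(P, M) \<in> Ob (CPMod K)"
  shows "\<exists>w. moebius_inversion (bar_poset P) (nullity K (P, M)) w \<and>
    finite {x \<in> Field (bar_poset P). w x \<noteq> 0}"
proof -
  have P: "Partial_order P" and F: "cat_functor (poset_cat P) (vec_cat K) M"
    using M by (auto simp: CPMod_def full_subcategory_def Ob_PMod)
  obtain c where c: "coclosure_operator P c" and fin: "finite (c ` Field P)"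
    and iso: "naturally_isomorphic (poset_cat P) (vec_cat K)
      (fctr_comp (poset_cat P) M (map_fctr P c)) M"
    using M by (auto simp: CPMod_def full_subcategory_def constructible_def constructible_on_def)
  have co: "c \<in> order_preserving P P"
    using c by (simp add: coclosure_operator_def)
  show ?thesis
  proof (rule coclosure_moebius_inversion[OF Partial_order_bar_poset[OF P]
        coclosure_operator_bar_poset[OF P c]])
    show "finite (restrict (map_prod c c) P ` Field (bar_poset P))"
      by (rule finite_subset[OF _ finite_cartesian_product[OF fin fin]])
        (auto simp: Field_bar_poset[OF P] FieldI1 FieldI2)
    show "nullity K (P, M) y = nullity K (P, M) (restrict (map_prod c c) P y)"
      if "y \<in> Field (bar_poset P)" for y
      using that nullity_reparametrised[OF P P co F F iso] by (simp add: Field_bar_poset[OF P])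
  qed
qed


section \<open>The persistence diagram functor\<close>

definition nullity_diagram :: "('k, 'r) ring_scheme \<Rightarrow> ('a, 'k, 'v) pmodule \<Rightarrow> 'a diagram"
  where "nullity_diagram K X =
    (fst X, THE w. moebius_inversion (bar_poset (fst X)) (nullity K X) w)"

lemma nullity_diagram_eq:
  assumes "Partial_order P" "moebius_inversion (bar_poset P) (nullity K (P, M)) w"
  shows "nullity_diagram K (P, M) = (P, w)"
  using moebius_inversion_unique[OF Partial_order_bar_poset[OF assms(1)]] assms(2)
  by (auto simp: nullity_diagram_def intro!: the_equality)

text \<open>
  A Galois insertion acts coordinatewise as a Galois connection between the posets of pairs, and the
  nullity of the target is that of the source composed with the right adjoint. Hence the pushforward
  of the first diagram is the Moebius inversion of the second nullity; the two diagrams then agree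
  even on the diagonal.
\<close>

lemma nullity_diagram_morphism:
  assumes M: "(P, M) \<in> Ob (CPMod K)" and N: "(Q, N) \<in> Ob (CPMod K)"
    and fg: "(f, g) \<in> Hom (PMod K) (P, M) (Q, N)"
  shows "f \<in> Hom Dgm (nullity_diagram K (P, M)) (nullity_diagram K (Q, N))"
proof -
  have P: "Partial_order P" and FM: "cat_functor (poset_cat P) (vec_cat K) M"
    and Q: "Partial_order Q" and FN: "cat_functor (poset_cat Q) (vec_cat K) N"
    using M N by (auto simp: CPMod_def full_subcategory_def Ob_PMod)
  have fo: "f \<in> order_preserving P Q" and go: "g \<in> order_preserving Q P"
    and adj: "\<And>p q. \<lbrakk>p \<in> Field P; q \<in> Field Q\<rbrakk> \<Longrightarrow> (f p, q) \<in> Q \<longleftrightarrow> (p, g q) \<in> P"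
    and iso: "naturally_isomorphic (poset_cat Q) (vec_cat K)
      (fctr_comp (poset_cat Q) M (map_fctr Q g)) N"
    using fg by (auto simp: Hom_PMod galois_insertion_def)
  obtain u where u: "moebius_inversion (bar_poset P) (nullity K (P, M)) u"
    and fin: "finite {x \<in> Field (bar_poset P). u x \<noteq> 0}"
    using nullity_moebius_inversion[OF M] by blast
  let ?v = "restrict (pushforward (Field (bar_poset P)) (map_prod f f) u) (Field (bar_poset Q))"
  have "moebius_inversion (bar_poset Q) (nullity K (Q, N)) ?v"
  proof (rule moebius_inversion_pushforward(1)[OF u fin, where g = "map_prod g g"])
    show "map_prod f f x \<in> Field (bar_poset Q)" if "x \<in> Field (bar_poset P)" for x
      using that order_preserving_mono[OF fo] by (cases x) (auto simp: Field_bar_poset P Q)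
    show "map_prod g g y \<in> Field (bar_poset P)" if "y \<in> Field (bar_poset Q)" for y
      using that order_preserving_mono[OF go] by (cases y) (auto simp: Field_bar_poset P Q)
    show "(map_prod f f x, y) \<in> bar_poset Q \<longleftrightarrow> (x, map_prod g g y) \<in> bar_poset P"
      if "x \<in> Field (bar_poset P)" "y \<in> Field (bar_poset Q)" for x y
      using that order_preserving_mono[OF fo] order_preserving_mono[OF go] adj
      by (cases x; cases y) (auto simp: Field_bar_poset P Q bar_poset_iff FieldI1 FieldI2)
    show "nullity K (Q, N) y = nullity K (P, M) (map_prod g g y)"
      if "y \<in> Field (bar_poset Q)" for y
      using that nullity_reparametrised[OF P Q go FM FN iso] by (simp add: Field_bar_poset Q)
  qed
  then have "nullity_diagram K (Q, N) = (Q, ?v)"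
    by (rule nullity_diagram_eq[OF Q])
  moreover have "nullity_diagram K (P, M) = (P, u)"
    by (rule nullity_diagram_eq[OF P u])
  ultimately show ?thesis
    using fo by (simp add: Hom_Dgm off_diagonal_def)
qed

theorem proposition4p13:
  fixes K :: "('k, 'r) ring_scheme"
  assumes "field K"
  shows "\<exists>PD :: (('a, 'k, 'v) pmodule, ('a \<Rightarrow> 'a) \<times> ('a \<Rightarrow> 'a), 'a diagram, 'a \<Rightarrow> 'a) fctr.
    cat_functor (CPMod K) Dgm PD \<and>
    (\<forall>P M. (P, M) \<in> Ob (CPMod K) \<longrightarrow>
      (\<exists>w. moebius_inversion (bar_poset P) (nullity K (P, M)) w \<and> FOb PD (P, M) = (P, w)))"
proof -
  let ?C = "CPMod K :: (('a, 'k, 'v) pmodule, ('a \<Rightarrow> 'a) \<times> ('a \<Rightarrow> 'a)) cat"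
  define PD :: "(('a, 'k, 'v) pmodule, ('a \<Rightarrow> 'a) \<times> ('a \<Rightarrow> 'a), 'a diagram, 'a \<Rightarrow> 'a) fctr"
    where "PD = \<lparr>FOb = restrict (nullity_diagram K) (Ob ?C),
      FAr = (\<lambda>X Y F. if X \<in> Ob ?C \<and> Y \<in> Ob ?C \<and> F \<in> Hom ?C X Y then fst F else undefined)\<rparr>"
  have same [simp]: "Hom ?C = Hom (PMod K)" "Idn ?C = Idn (PMod K)" "Cmp ?C = Cmp (PMod K)"
    by (simp_all add: CPMod_def full_subcategory_def)
  interpret C: category ?C
    unfolding CPMod_def by (rule category_full_subcategory[OF category_PMod])
  interpret D: category "Dgm :: ('a diagram, 'a \<Rightarrow> 'a) cat"
    by (rule category_Dgm)
  have po: "Partial_order P" if "(P, M) \<in> Ob ?C" for P M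
    using that by (auto simp: CPMod_def full_subcategory_def Ob_PMod)
  have diagram: "\<exists>w. moebius_inversion (bar_poset P) (nullity K (P, M)) w \<and>
      nullity_diagram K (P, M) = (P, w) \<and> (P, w) \<in> Ob Dgm" if "(P, M) \<in> Ob ?C" for P M
    using nullity_moebius_inversion[OF that] nullity_diagram_eq[OF po[OF that]] po[OF that]
    by (auto simp: Ob_Dgm moebius_inversion_def)
  have "cat_functor ?C Dgm PD"
  proof unfold_locales
    fix X assume X: "X \<in> Ob ?C"
    then show "FOb PD X \<in> Ob Dgm"
      using diagram by (cases X) (fastforce simp: PD_def)
    show "FAr PD X X (Idn ?C X) = Idn Dgm (FOb PD X)"
      using X C.Idn_in_Hom[OF X] by (cases X) (auto simp: PD_def nullity_diagram_def Idn_PMod Idn_Dgm)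
  next
    fix X Y F assume "X \<in> Ob ?C" "Y \<in> Ob ?C" "F \<in> Hom ?C X Y"
    then show "FAr PD X Y F \<in> Hom Dgm (FOb PD X) (FOb PD Y)"
      by (cases X; cases Y; cases F) (auto simp: PD_def nullity_diagram_morphism)
  next
    fix X Y Z F G
    assume h: "X \<in> Ob ?C" "Y \<in> Ob ?C" "Z \<in> Ob ?C" "F \<in> Hom ?C X Y" "G \<in> Hom ?C Y Z"
    then show "FAr PD X Z (Cmp ?C X Y Z G F)
        = Cmp Dgm (FOb PD X) (FOb PD Y) (FOb PD Z) (FAr PD Y Z G) (FAr PD X Y F)"
      using C.Cmp_in_Hom[OF h]
      by (cases X; cases Y; cases Z; cases F; cases G)
        (auto simp: PD_def nullity_diagram_def Cmp_PMod Cmp_Dgm)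
  qed (auto simp: PD_def)
  moreover have "\<exists>w. moebius_inversion (bar_poset P) (nullity K (P, M)) w \<and> FOb PD (P, M) = (P, w)"
    if "(P, M) \<in> Ob ?C" for P M
    using diagram[OF that] that by (auto simp: PD_def)
  ultimately show ?thesis
    by blast
qed

end
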